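(* Let $H$ be a digraph (possibly with loops), let $D$ be an $H$-colored digraph, and let $\mathscr{F}$ be an $H$-class partition of $A(D)$ such that for every $F\in\mathscr{F}$, the arc-induced subdigraph $D\langle F\rangle$ is strongly connected and contains a vertex that is obstruction-free in $D$. Then for every $k\geq 2$, $D$ has a $(k,H)$-kernel by walks.
   Context: $H$ is a digraph possibly with loops; an $H$-colored digraph is a finite digraph $D$ without loops together with a coloring $\rho:A(D)\to V(H)$. For $x\in V(D)$, $A^-(x)$ and $A^+(x)$ denote the sets of arcs of $D$ entering and leaving $x$. A vertex $x$ is obstruction-free in $D$ if $(\rho(a),\rho(b))\in A(H)$ for all $a\in A^-(x)$, $b\in A^+(x)$. For $F\subseteq A(D)$, $D\langle F\rangle$ is the digraph with arc set $F$ and vertex set the vertices of $D$ incident with at least one arc of $F$. An $H$-class partition of $A(D)$ is a partition $\mathscr{F}$ of $A(D)$ such that for every pair of arcs $(u,v),(v,w)$ of $D$, $(\rho(u,v),\rho(v,w))\in A(H)$ if and only if there is $F\in\mathscr{F}$ with $\{(u,v),(v,w)\}\subseteq F$. For a walk $W=(x_0,\ldots,x_n)$ in $D$ there is an obstruction on $x_i$ if $(\rho(x_{i-1},x_i),\rho(x_i,x_{i+1}))\notin A(H)$; for an open walk, $O_H(W)$ is the set of $i\in\{1,\ldots,n-1\}$ with an obstruction on $x_i$, and the $H$-length is $l_H(W)=|O_H(W)|+1$ (for a closed walk indices are taken mod $n$, $i$ ranges over $\{0,\ldots,n-1\}$, and $l_H(W)=|O_H(W)|$). For $k\ge 2$,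 $l\ge 1$, a set $S\subseteq V(D)$ is a $(k,l,H)$-kernel by walks if every walk in $D$ between two different vertices of $S$ has $H$-length at least $k$, and for every $x\in V(D)\setminus S$ there is a walk from $x$ to some vertex of $S$ with $H$-length at most $l$. A $(k,H)$-kernel by walks is a $(k,k-1,H)$-kernel by walks. *)

theory Defs
  imports "Graph_Theory.Graph_Theory" "HOL-Library.Disjoint_Sets"
begin

text \<open>Neither digraph needs to be nonempty, and \<open>H\<close> need not be finite.\<close>

locale H_colored_digraph = H: pair_wf_digraph H + D: pair_digraph D
  for H :: "'c pair_pre_digraph" and D :: "'a pair_pre_digraph" +
  fixes \<rho> :: "'a \<times> 'a \<Rightarrow> 'c"
  assumes color_in_verts: "a \<in> parcs D \<Longrightarrow> \<rho> a \<in> pverts H"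

definition obstruction_free ::
  "'c pair_pre_digraph \<Rightarrow> 'a pair_pre_digraph \<Rightarrow> ('a \<times> 'a \<Rightarrow> 'c) \<Rightarrow> 'a \<Rightarrow> bool" where
  "obstruction_free H D \<rho> x \<longleftrightarrow>
     x \<in> pverts D \<and> (\<forall>a \<in> in_arcs D x. \<forall>b \<in> out_arcs D x. (\<rho> a, \<rho> b) \<in> parcs H)"

definition arc_induced :: "'a pair_pre_digraph \<Rightarrow> ('a \<times> 'a) set \<Rightarrow> 'a pair_pre_digraph" where
  "arc_induced D F =
     \<lparr> pverts = {x \<in> pverts D. \<exists>a \<in> F. x = fst a \<or> x = snd a}, parcs = F \<rparr>"

definition H_class_partition ::
  "'c pair_pre_digraph \<Rightarrow> 'a pair_pre_digraph \<Rightarrow> ('a \<times> 'a \<Rightarrow> 'c) \<Rightarrow> ('a \<times> 'a) set set \<Rightarrow> bool" where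
  "H_class_partition H D \<rho> \<F> \<longleftrightarrow> partition_on (parcs D) \<F> \<and>
     (\<forall>u v w. (u, v) \<in> parcs D \<longrightarrow> (v, w) \<in> parcs D \<longrightarrow>
        ((\<rho> (u, v), \<rho> (v, w)) \<in> parcs H \<longleftrightarrow> (\<exists>F \<in> \<F>. {(u, v), (v, w)} \<subseteq> F)))"

text \<open>
  A walk \<open>(x\<^sub>0, \<dots>, x\<^sub>n)\<close> is represented by its list of vertices, of length \<open>n + 1\<close>.
  In the closed case \<open>x\<^sub>n = x\<^sub>0\<close>, and \<open>i + (n - 1)\<close> stands for \<open>i - 1\<close> modulo \<open>n\<close>.
\<close>

definition open_obstructions ::
  "'c pair_pre_digraph \<Rightarrow> ('a \<times> 'a \<Rightarrow> 'c) \<Rightarrow> 'a vwalk \<Rightarrow> nat set" where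
  "open_obstructions H \<rho> W =
     {i. 1 \<le> i \<and> i < vwalk_length W \<and>
         (\<rho> (W ! (i - 1), W ! i), \<rho> (W ! i, W ! (i + 1))) \<notin> parcs H}"

definition closed_obstructions ::
  "'c pair_pre_digraph \<Rightarrow> ('a \<times> 'a \<Rightarrow> 'c) \<Rightarrow> 'a vwalk \<Rightarrow> nat set" where
  "closed_obstructions H \<rho> W =
     (let n = vwalk_length W in
      {i. i < n \<and>
          (\<rho> (W ! ((i + (n - 1)) mod n), W ! i), \<rho> (W ! i, W ! ((i + 1) mod n))) \<notin> parcs H})"

definition H_length ::
  "'c pair_pre_digraph \<Rightarrow> ('a \<times> 'a \<Rightarrow> 'c) \<Rightarrow> 'a vwalk \<Rightarrow> nat" where
  "H_length H \<rho> W =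
     (if hd W = last W then card (closed_obstructions H \<rho> W)
      else card (open_obstructions H \<rho> W) + 1)"

definition klH_kernel_by_walks ::
  "nat \<Rightarrow> nat \<Rightarrow> 'c pair_pre_digraph \<Rightarrow> 'a pair_pre_digraph \<Rightarrow> ('a \<times> 'a \<Rightarrow> 'c) \<Rightarrow> 'a set \<Rightarrow> bool"
  where
  "klH_kernel_by_walks k l H D \<rho> S \<longleftrightarrow> S \<subseteq> pverts D \<and>
     (\<forall>W. vwalk W D \<longrightarrow> hd W \<in> S \<longrightarrow> last W \<in> S \<longrightarrow> hd W \<noteq> last W \<longrightarrow> k \<le> H_length H \<rho> W) \<and>
     (\<forall>x \<in> pverts D - S. \<exists>W. vwalk W D \<and> hd W = x \<and> last W \<in> S \<and> H_length H \<rho> W \<le> l)"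

definition kH_kernel_by_walks ::
  "nat \<Rightarrow> 'c pair_pre_digraph \<Rightarrow> 'a pair_pre_digraph \<Rightarrow> ('a \<times> 'a \<Rightarrow> 'c) \<Rightarrow> 'a set \<Rightarrow> bool"
  where
  "kH_kernel_by_walks k H D \<rho> S \<longleftrightarrow> klH_kernel_by_walks k (k - 1) H D \<rho> S"

end

theory Submission
  imports Defs
begin

text \<open>
  Call two vertices related if they lie in a common \<open>D\<langle>F\<rangle>\<close>. As every \<open>D\<langle>F\<rangle>\<close> is strongly
  connected, a walk of \<open>H\<close>-length at most \<open>m\<close> joins distinct \<open>x\<close> and \<open>y\<close> iff \<open>y\<close> is reached from \<open>x\<close> in
  \<open>m\<close> related steps, a symmetric condition. Hence a maximal set \<open>S\<close> of obstruction-free vertices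
  without short walks between them also absorbs the obstruction-free vertices outside \<open>S\<close>. An
  obstruction-free vertex lies in a single \<open>D\<langle>F\<rangle>\<close>, so whatever absorbs it absorbs all of \<open>D\<langle>F\<rangle>\<close>.
\<close>

section \<open>Counting obstructions along a walk\<close>

lemma finite_open_obstructions: "finite (open_obstructions H \<rho> W)"
  by (rule finite_subset[of _ "{..<vwalk_length W}"]) (auto simp: open_obstructions_def)

lemma zero_notin_open_obstructions: "0 \<notin> open_obstructions H \<rho> W"
  by (simp add: open_obstructions_def)

lemma Suc_in_open_obstructions:
  "Suc i \<in> open_obstructions H \<rho> W \<longleftrightarrow> Suc (Suc i) < length W \<and>
     (\<rho> (W ! i, W ! Suc i), \<rho> (W ! Suc i, W ! Suc (Suc i))) \<notin> parcs H"
  by (auto simp: open_obstructions_def)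

lemma open_obstructions_eq_empty: "length W \<le> 2 \<Longrightarrow> open_obstructions H \<rho> W = {}"
  by (auto simp: open_obstructions_def)

text \<open>Prepending \<open>u\<close> shifts every index by one, and the only new inner vertex is
  \<open>v\<close>, at index 1.\<close>

lemma open_obstructions_Cons:
  "open_obstructions H \<rho> (u # v # w # p) =
     (if (\<rho> (u, v), \<rho> (v, w)) \<in> parcs H then {} else {1}) \<union>
     Suc ` open_obstructions H \<rho> (v # w # p)" (is "?L = ?R")
proof (rule set_eqI)
  fix i
  consider "i = 0" | "i = Suc 0" | j where "i = Suc (Suc j)"
    by (cases i; cases "i - 1") auto
  then show "i \<in> ?L \<longleftrightarrow> i \<in> ?R"
  proof cases
    case 1
    then show ?thesis by (simp add: zero_notin_open_obstructions)
  next
    case 2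
    have "Suc 0 \<in> Suc ` A \<longleftrightarrow> 0 \<in> A" for A
      by (rule inj_image_mem_iff) simp
    then show ?thesis
      by (simp add: 2 Suc_in_open_obstructions zero_notin_open_obstructions)
  next
    case (3 j)
    have "Suc (Suc j) \<in> Suc ` A \<longleftrightarrow> Suc j \<in> A" for A
      by (rule inj_image_mem_iff) simp
    then show ?thesis by (simp add: 3 Suc_in_open_obstructions)
  qed
qed

lemma card_open_obstructions_Cons:
  "card (open_obstructions H \<rho> (u # v # w # p)) =
     (if (\<rho> (u, v), \<rho> (v, w)) \<in> parcs H then 0 else 1) +
     card (open_obstructions H \<rho> (v # w # p))"
proof -
  let ?A = "Suc ` open_obstructions H \<rho> (v # w # p)"
  have "Suc 0 \<notin> ?A"
    using zero_notin_open_obstructions[of H \<rho> "v # w # p"] by (metis imageE nat.inject)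
  moreover have "finite ?A" by (simp add: finite_open_obstructions)
  moreover have "card ?A = card (open_obstructions H \<rho> (v # w # p))"
    by (rule card_image) simp
  ultimately show ?thesis by (simp add: open_obstructions_Cons)
qed

lemma card_open_obstructions_Cons_le:
  "card (open_obstructions H \<rho> (u # p)) \<le> Suc (card (open_obstructions H \<rho> p))"
proof (cases p rule: vwalk_arcs.cases)
  case 1
  then show ?thesis by (simp add: open_obstructions_eq_empty)
next
  case (2 v)
  then show ?thesis by (simp add: open_obstructions_eq_empty)
next
  case (3 v w q)
  then show ?thesis by (simp add: card_open_obstructions_Cons)
qed

section \<open>Maximal independent sets\<close>

text \<open>An inclusion-maximal independent set works: a point of \<open>P\<close> outside it that
  is joined to it in neither direction could be added. As \<open>R\<close> need not be symmetric,
  the direction is left open.\<close>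

lemma finite_maximal_independent:
  assumes "finite P"
  obtains S where "S \<subseteq> P" and "\<And>x y. x \<in> S \<Longrightarrow> y \<in> S \<Longrightarrow> x \<noteq> y \<Longrightarrow> (x, y) \<notin> R"
    and "\<And>x. x \<in> P \<Longrightarrow> x \<notin> S \<Longrightarrow> \<exists>y \<in> S. (x, y) \<in> R \<or> (y, x) \<in> R"
proof -
  let ?A = "{S. S \<subseteq> P \<and> (\<forall>x \<in> S. \<forall>y \<in> S. x \<noteq> y \<longrightarrow> (x, y) \<notin> R)}"
  have "finite ?A" by (rule finite_subset[of _ "Pow P"]) (use assms in auto)
  moreover have "?A \<noteq> {}" by (rule ex_in_conv[THEN iffD1], rule exI[of _ "{}"]) simp
  ultimately have "\<exists>S \<in> ?A. \<forall>T \<in> ?A. S \<subseteq> T \<longrightarrow> S = T"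
    by (rule finite_has_maximal)
  then obtain S where S: "S \<in> ?A" and max: "\<And>T. T \<in> ?A \<Longrightarrow> S \<subseteq> T \<Longrightarrow> S = T"
    by meson
  have "\<exists>y \<in> S. (x, y) \<in> R \<or> (y, x) \<in> R" if x: "x \<in> P" "x \<notin> S" for x
  proof (rule ccontr)
    assume "\<not> ?thesis"
    then have "insert x S \<in> ?A" using S x by auto
    then show False using max[of "insert x S"] x by blast
  qed
  then show ?thesis using S that by blast
qed

section \<open>Arc classes and chains of related vertices\<close>

locale strong_H_class_digraph = D: pair_digraph D
  for D :: "'a pair_pre_digraph" +
  fixes H :: "'c pair_pre_digraph" and \<rho> :: "'a \<times> 'a \<Rightarrow> 'c" and \<F> :: "('a \<times> 'a) set set"
  assumes class_partition: "H_class_partition H D \<rho> \<F>"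
    and class_strong: "F \<in> \<F> \<Longrightarrow> strongly_connected (arc_induced D F)"
begin

abbreviation class_verts :: "('a \<times> 'a) set \<Rightarrow> 'a set" where
  "class_verts F \<equiv> pverts (arc_induced D F)"

text \<open>Reflexive only on vertices that lie in some class, and in general not transitive, since
  a vertex may lie in several classes.\<close>

definition related :: "'a rel" where
  "related = {(u, v). \<exists>F \<in> \<F>. u \<in> class_verts F \<and> v \<in> class_verts F}"

lemma class_subset: "F \<in> \<F> \<Longrightarrow> F \<subseteq> parcs D"
  using class_partition by (auto simp: H_class_partition_def partition_on_def)

lemma arc_in_class:
  assumes "a \<in> parcs D"
  obtains F where "F \<in> \<F>" "a \<in> F"
proof -
  have "\<Union>\<F> = parcs D"
    using class_partition by (simp add: H_class_partition_def partition_on_def)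
  with assms that show ?thesis by blast
qed

lemma class_unique: "F \<in> \<F> \<Longrightarrow> G \<in> \<F> \<Longrightarrow> a \<in> F \<Longrightarrow> a \<in> G \<Longrightarrow> F = G"
  using class_partition disjointD[of \<F> F G]
  unfolding H_class_partition_def partition_on_def by blast

lemma class_verts_arc:
  assumes "F \<in> \<F>" "(u, v) \<in> F"
  shows "u \<in> class_verts F" "v \<in> class_verts F"
proof -
  have "(u, v) \<in> parcs D" using assms class_subset by blast
  then have "u \<in> pverts D" "v \<in> pverts D"
    using D.in_arcsD1 D.in_arcsD2 by auto
  then show "u \<in> class_verts F" "v \<in> class_verts F"
    using assms(2) by (force simp: arc_induced_def)+
qed

lemma class_verts_subset: "class_verts F \<subseteq> pverts D"
  by (auto simp: arc_induced_def)

text \<open>The classes are disjoint, so a class containing both arcs can only be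
  \<open>F\<close>.\<close>

lemma no_obstruction_iff:
  assumes "F \<in> \<F>" "(u, v) \<in> F" "(v, w) \<in> parcs D"
  shows "(\<rho> (u, v), \<rho> (v, w)) \<in> parcs H \<longleftrightarrow> (v, w) \<in> F"
proof -
  have "(u, v) \<in> parcs D" using assms class_subset by blast
  then have "(\<rho> (u, v), \<rho> (v, w)) \<in> parcs H \<longleftrightarrow> (\<exists>G \<in> \<F>. {(u, v), (v, w)} \<subseteq> G)"
    using class_partition assms(3) by (simp add: H_class_partition_def)
  also have "\<dots> \<longleftrightarrow> (v, w) \<in> F"
    using assms(1,2) class_unique by blast
  finally show ?thesis .
qed

lemma class_reachable:
  "F \<in> \<F> \<Longrightarrow> u \<in> class_verts F \<Longrightarrow> v \<in> class_verts F \<Longrightarrow>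
     (u, v) \<in> rtrancl_on (class_verts F) F"
  using class_strong[of F]
  by (auto simp: strongly_connected_def reachable_def arc_induced_def)

text \<open>Absence of loops provides a second vertex in the class. By strong connectedness there
  are paths in \<open>F\<close> from it to \<open>x\<close> and back; the last arc of the first and
  the first arc of the second are the arcs sought.\<close>

lemma class_in_out_arc:
  assumes "F \<in> \<F>" "x \<in> class_verts F"
  obtains y z where "(y, x) \<in> F" "(x, z) \<in> F"
proof -
  obtain p q where a: "(p, q) \<in> F"
    using assms(2) by (auto simp: arc_induced_def)
  then have "p \<noteq> q" using assms(1) class_subset D.no_loops by fastforce
  then obtain w where w: "w \<in> class_verts F" "w \<noteq> x"
    using class_verts_arc[OF assms(1) a] by (cases "p = x") auto
  have "(w, x) \<in> F\<^sup>*" "(x, w) \<in> F\<^sup>*"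
    by (rule rtrancl_on_rtranclI, rule class_reachable; use assms w in simp)+
  moreover obtain y where "(y, x) \<in> F"
    using calculation(1) w(2) by (blast elim: rtranclE)
  moreover obtain z where "(x, z) \<in> F"
    using calculation(2) w(2) by (blast elim: converse_rtranclE)
  ultimately show ?thesis using that by blast
qed

text \<open>An arc of \<open>F\<close> enters \<open>x\<close> and an arc of \<open>G\<close> leaves
  it; without an obstruction at \<open>x\<close> the two lie in the same class.\<close>

lemma obstruction_free_unique_class:
  assumes "obstruction_free H D \<rho> x"
    and "F \<in> \<F>" "x \<in> class_verts F" "G \<in> \<F>" "x \<in> class_verts G"
  shows "F = G"
proof -
  obtain y where y: "(y, x) \<in> F" by (rule class_in_out_arc[OF assms(2,3)])
  obtain z where z: "(x, z) \<in> G" by (rule class_in_out_arc[OF assms(4,5)])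
  have arcs: "(y, x) \<in> parcs D" "(x, z) \<in> parcs D"
    using y class_subset[OF assms(2)] z class_subset[OF assms(4)] by auto
  then have "(\<rho> (y, x), \<rho> (x, z)) \<in> parcs H"
    using assms(1) by (simp add: obstruction_free_def)
  then have "(x, z) \<in> F" using no_obstruction_iff[OF assms(2) y arcs(2)] by simp
  from class_unique[OF assms(2,4) this z] show ?thesis .
qed

lemma sym_related: "sym related"
  by (auto simp: related_def sym_def)

lemma sym_related_pow: "sym (related ^^ n)"
proof (induction n)
  case 0
  show ?case by (auto simp: sym_def)
next
  case (Suc n)
  show ?case
  proof (rule symI)
    fix x y
    assume "(x, y) \<in> related ^^ Suc n"
    then obtain z where "(x, z) \<in> related ^^ n" "(z, y) \<in> related" by auto
    then have "(z, x) \<in> related ^^ n" "(y, z) \<in> related"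
      using Suc.IH sym_related by (auto dest: symD)
    then show "(y, x) \<in> related ^^ Suc n" by (blast intro: relpow_Suc_I2)
  qed
qed

lemma related_refl: "(x, y) \<in> related \<Longrightarrow> (x, x) \<in> related"
  by (auto simp: related_def)

text \<open>A chain is lengthened by repeating its first vertex, which is related to itself once the
  chain has a step; hence \<open>0 < m\<close>.\<close>

lemma related_pow_mono:
  assumes "(x, y) \<in> related ^^ m" "0 < m" "m \<le> n"
  shows "(x, y) \<in> related ^^ n"
  using assms(3)
proof (induction n rule: dec_induct)
  case base
  show ?case by (fact assms(1))
next
  case (step n)
  then obtain n' where "n = Suc n'" using assms(2) by (cases n) auto
  then have "(x, x) \<in> related"
    using step.IH relpow_Suc_D2[of x y n' related] related_refl by blast
  then show ?case using step.IH by (rule relpow_Suc_I2)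
qed

section \<open>From walks to chains\<close>

text \<open>
  The first vertex may be replaced by any vertex \<open>z\<close> in the class of the first arc: this is
  what makes the induction work when consecutive arcs lie in the same class.
\<close>

lemma vwalk_imp_related_pow:
  assumes "vwalk (u # v # p) D" "F \<in> \<F>" "(u, v) \<in> F" "z \<in> class_verts F"
  shows "(z, last (v # p)) \<in> related ^^ Suc (card (open_obstructions H \<rho> (u # v # p)))"
  using assms
proof (induction p arbitrary: u v F z)
  case Nil
  then have "(z, v) \<in> related"
    using class_verts_arc(2)[OF Nil(2,3)] by (auto simp: related_def)
  then show ?case by (simp add: open_obstructions_eq_empty)
next
  case (Cons w p)
  have arc: "(v, w) \<in> parcs D" and walk: "vwalk (v # w # p) D"
    using Cons.prems(1) by (auto simp: vwalk_def)
  show ?case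
  proof (cases "(\<rho> (u, v), \<rho> (v, w)) \<in> parcs H")
    case True
    \<comment> \<open>The walk stays in \<open>F\<close>, so the same \<open>z\<close> serves for
      its tail.\<close>
    then have "(v, w) \<in> F" using no_obstruction_iff[OF Cons.prems(2,3) arc] by simp
    from Cons.IH[OF walk Cons.prems(2) this Cons.prems(4)] True show ?thesis
      by (simp add: card_open_obstructions_Cons)
  next
    case False
    obtain G where G: "G \<in> \<F>" "(v, w) \<in> G" by (rule arc_in_class[OF arc])
    then have "v \<in> class_verts G" by (rule class_verts_arc)
    note * = Cons.IH[OF walk G this]
    \<comment> \<open>The obstruction at \<open>v\<close> pays for one step from \<open>z\<close> to
      \<open>v\<close> inside \<open>F\<close>; \<open>v\<close> then plays the role of
      \<open>z\<close> in the new class \<open>G\<close>.\<close>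
    have "(z, v) \<in> related"
      using Cons.prems(2,4) class_verts_arc(2)[OF Cons.prems(2,3)] by (auto simp: related_def)
    from relpow_Suc_I2[OF this *] False show ?thesis
      by (simp add: card_open_obstructions_Cons)
  qed
qed

lemma H_length_imp_related_pow:
  assumes "vwalk W D" "hd W \<noteq> last W"
  shows "(hd W, last W) \<in> related ^^ H_length H \<rho> W"
proof -
  obtain u v p where W: "W = u # v # p"
    using assms by (cases W rule: vwalk_arcs.cases) (auto simp: vwalk_def)
  then have "(u, v) \<in> parcs D" using assms(1) by (auto simp: vwalk_def)
  then obtain F where F: "F \<in> \<F>" "(u, v) \<in> F" by (rule arc_in_class)
  show ?thesis
    using vwalk_imp_related_pow[of u v p F u] F assms class_verts_arc[OF F]
    by (simp add: W H_length_def)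
qed

section \<open>From chains back to walks\<close>

text \<open>Only the first arc put in front of \<open>p\<close> can create an obstruction, at
  \<open>v\<close>, and none if \<open>p\<close> is a single vertex. The last conjunct is the
  invariant behind this: once \<open>q\<close> starts with an arc of \<open>F\<close>, a further arc
  of \<open>F\<close> in front adds no obstruction.\<close>

lemma class_vwalk_prepend:
  assumes "(u, v) \<in> rtrancl_on (class_verts F) F" "F \<in> \<F>" "vwalk p D" "hd p = v"
  shows "\<exists>q. vwalk q D \<and> hd q = u \<and> last q = last p \<and>
    card (open_obstructions H \<rho> q) \<le>
      (if tl p = [] then 0 else Suc (card (open_obstructions H \<rho> p))) \<and>
    (q = p \<or> (\<exists>w r. q = u # w # r \<and> (u, w) \<in> F))"
    (is "\<exists>q. _ \<and> _ \<and> _ \<and> _ \<le> ?bound \<and> _")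
  using assms(1)
proof (induction rule: converse_rtrancl_on_induct)
  case base
  have "open_obstructions H \<rho> p = {}" if "tl p = []"
    using that by (cases p) (auto simp: open_obstructions_eq_empty)
  then show ?case using assms(3,4) by auto
next
  case (step u u')
  then obtain q where q: "vwalk q D" "hd q = u'" "last q = last p"
    "card (open_obstructions H \<rho> q) \<le> ?bound"
    "q = p \<or> (\<exists>w r. q = u' # w # r \<and> (u', w) \<in> F)" by blast
  obtain r where r: "q = u' # r" using q(1,2) by (cases q) (auto simp: vwalk_def)
  have "(u, u') \<in> parcs D" using step(1) class_subset[OF assms(2)] by blast
  moreover have "u \<in> pverts D" using step class_verts_subset by blast
  ultimately have walk: "vwalk (u # q) D"
    using q(1) by (auto simp: vwalk_def r)
  have "card (open_obstructions H \<rho> (u # q)) \<le> ?bound"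
    using q(5)
  proof
    assume "q = p"
    then show ?thesis
      using card_open_obstructions_Cons_le[of H \<rho> u p] r by (auto simp: open_obstructions_eq_empty)
  next
    assume "\<exists>w r. q = u' # w # r \<and> (u', w) \<in> F"
    then obtain w r where w: "q = u' # w # r" "(u', w) \<in> F" by blast
    moreover have "(\<rho> (u, u'), \<rho> (u', w)) \<in> parcs H"
      using no_obstruction_iff[OF assms(2) step(1)] w(2) class_subset[OF assms(2)] by blast
    ultimately show ?thesis using q(4) by (simp add: card_open_obstructions_Cons)
  qed
  moreover have "last (u # q) = last p" using q(3) r by simp
  ultimately show ?case using walk r step by (intro exI[of _ "u # q"]) auto
qed

text \<open>Each further step of the chain prepends a path inside one class, at the cost of at most
  one obstruction. Obstructions are counted in place of \<open>H_length\<close>, which counts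
  cyclically when the ends of the walk coincide.\<close>

lemma related_pow_imp_vwalk:
  assumes "(x, y) \<in> related ^^ Suc n"
  shows "\<exists>W. vwalk W D \<and> hd W = x \<and> last W = y \<and> card (open_obstructions H \<rho> W) \<le> n"
  using assms
proof (induction n arbitrary: x)
  case 0
  then obtain F where F: "F \<in> \<F>" "x \<in> class_verts F" "y \<in> class_verts F"
    by (auto simp: related_def)
  have "vwalk [y] D" using F(3) class_verts_subset by (auto simp: vwalk_def)
  from class_vwalk_prepend[OF class_reachable[OF F] F(1) this] show ?case by auto
next
  case (Suc n)
  then obtain z where z: "(x, z) \<in> related" "(z, y) \<in> related ^^ Suc n"
    by (meson relpow_Suc_D2)
  from Suc.IH[OF z(2)] obtain p where p: "vwalk p D" "hd p = z" "last p = y"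
    "card (open_obstructions H \<rho> p) \<le> n" by blast
  obtain F where F: "F \<in> \<F>" "x \<in> class_verts F" "z \<in> class_verts F"
    using z(1) by (auto simp: related_def)
  from class_vwalk_prepend[OF class_reachable[OF F] F(1) p(1,2)]
  obtain q where "vwalk q D" "hd q = x" "last q = last p"
    "card (open_obstructions H \<rho> q) \<le> Suc (card (open_obstructions H \<rho> p))"
    by (auto split: if_splits)
  with p(3,4) show ?case by (intro exI[of _ q]) auto
qed

lemma related_pow_imp_H_length:
  assumes "(x, y) \<in> related ^^ n" "x \<noteq> y"
  shows "\<exists>W. vwalk W D \<and> hd W = x \<and> last W = y \<and> H_length H \<rho> W \<le> n"
proof (cases n)
  case 0
  then show ?thesis using assms by simp
next
  case (Suc m)
  with assms related_pow_imp_vwalk[of x y m] show ?thesis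
    by (force simp: H_length_def)
qed

section \<open>Construction of the kernel\<close>

theorem kH_kernel_exists:
  assumes obstruction_free_vert: "\<And>F. F \<in> \<F> \<Longrightarrow> \<exists>x \<in> class_verts F. obstruction_free H D \<rho> x"
    and k: "k \<ge> 2"
  shows "\<exists>S. kH_kernel_by_walks k H D \<rho> S"
proof -
  let ?R = "related ^^ (k - 1)" and ?P = "{x. obstruction_free H D \<rho> x}"
  have "?P \<subseteq> pverts D" by (auto simp: obstruction_free_def)
  moreover from this have "finite ?P" by (rule finite_subset) simp
  ultimately obtain S where S: "S \<subseteq> pverts D" "S \<subseteq> ?P"
    and indep: "\<And>x y. x \<in> S \<Longrightarrow> y \<in> S \<Longrightarrow> x \<noteq> y \<Longrightarrow> (x, y) \<notin> ?R"
    and max: "\<And>x. x \<in> ?P \<Longrightarrow> x \<notin> S \<Longrightarrow> \<exists>y \<in> S. (x, y) \<in> ?R \<or> (y, x) \<in> ?R"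
    using finite_maximal_independent[of ?P ?R] by (metis subset_trans)
  have "k \<le> H_length H \<rho> W"
    if W: "vwalk W D" "hd W \<in> S" "last W \<in> S" "hd W \<noteq> last W" for W
  proof (rule ccontr)
    assume "\<not> ?thesis"
    then have "H_length H \<rho> W \<le> k - 1" by simp
    \<comment> \<open>Positivity lets the chain be padded to exactly \<open>k - 1\<close>
      steps.\<close>
    moreover have "0 < H_length H \<rho> W" using W(4) by (simp add: H_length_def)
    ultimately have "(hd W, last W) \<in> ?R"
      using related_pow_mono H_length_imp_related_pow[OF W(1,4)] by blast
    then show False using indep W by blast
  qed
  moreover have "\<exists>W. vwalk W D \<and> hd W = x \<and> last W \<in> S \<and> H_length H \<rho> W \<le> k - 1"
    if x: "x \<in> pverts D" "x \<notin> S" for x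
  proof -
    \<comment> \<open>Such a chain suffices: \<open>x\<close> is outside \<open>S\<close>, so its
      ends differ and it yields a walk of \<open>H\<close>-length at most
      \<open>k - 1\<close>.\<close>
    have "\<exists>y \<in> S. (x, y) \<in> ?R"
    proof (cases "\<exists>F \<in> \<F>. x \<in> class_verts F")
      case True
      then obtain F z where F: "F \<in> \<F>" "x \<in> class_verts F"
        and z: "z \<in> class_verts F" "obstruction_free H D \<rho> z"
        using obstruction_free_vert by blast
      show ?thesis
      proof (cases "z \<in> S")
        case True
        have "(x, z) \<in> related ^^ 1" using F z(1) by (auto simp: related_def)
        then have "(x, z) \<in> ?R" by (rule related_pow_mono) (use k in auto)
        with True show ?thesis by blast
      next
        case False
        \<comment> \<open>Maximality may give either direction; symmetry turns it into a chain from
          \<open>z\<close>.\<close>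
        then obtain y where y: "y \<in> S" "(z, y) \<in> ?R"
          using max[of z] z(2) symD[OF sym_related_pow] by auto
        obtain m where m: "k - 1 = Suc m" using k by (cases "k - 1") auto
        with y(2) obtain w where w: "(z, w) \<in> related" "(w, y) \<in> related ^^ m"
          by (metis relpow_Suc_D2)
        then obtain G where G: "G \<in> \<F>" "z \<in> class_verts G" "w \<in> class_verts G"
          by (auto simp: related_def)
        \<comment> \<open>The first step of the chain from \<open>z\<close> cannot leave
          \<open>F\<close>, so the chain can start at \<open>x\<close> instead.\<close>
        have "G = F" by (rule obstruction_free_unique_class[OF z(2) G(1,2) F(1) z(1)])
        with G F have "(x, w) \<in> related" by (auto simp: related_def)
        then have "(x, y) \<in> ?R" using w(2) unfolding m by (rule relpow_Suc_I2)
        with y(1) show ?thesis by blast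
      qed
    next
      case False
      \<comment> \<open>A vertex in no class is incident with no arc, hence vacuously
        obstruction-free, and maximality of \<open>S\<close> applies to \<open>x\<close>
        itself.\<close>
      have "(u, v) \<notin> parcs D" if "u = x \<or> v = x" for u v
      proof
        assume "(u, v) \<in> parcs D"
        then obtain F where "F \<in> \<F>" "(u, v) \<in> F" by (rule arc_in_class)
        with class_verts_arc[OF this] False that show False by blast
      qed
      then have "obstruction_free H D \<rho> x"
        using x(1) by (fastforce simp: obstruction_free_def)
      then show ?thesis using max[of x] x(2) symD[OF sym_related_pow] by auto
    qed
    then show ?thesis using related_pow_imp_H_length x(2) by metis
  qed
  ultimately show ?thesis
    using S(1) by (auto simp: kH_kernel_by_walks_def klH_kernel_by_walks_def)
qed

end

theorem theorem9:
  fixes H :: "'c pair_pre_digraph" and D :: "'a pair_pre_digraph"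
    and \<rho> :: "'a \<times> 'a \<Rightarrow> 'c" and \<F> :: "('a \<times> 'a) set set" and k :: nat
  assumes "H_colored_digraph H D \<rho>"
    and "H_class_partition H D \<rho> \<F>"
    and "\<And>F. F \<in> \<F> \<Longrightarrow> strongly_connected (arc_induced D F)"
    and "\<And>F. F \<in> \<F> \<Longrightarrow> \<exists>x \<in> pverts (arc_induced D F). obstruction_free H D \<rho> x"
    and "k \<ge> 2"
  shows "\<exists>S. kH_kernel_by_walks k H D \<rho> S"
proof -
  interpret H_colored_digraph H D \<rho> by (fact assms(1))
  interpret strong_H_class_digraph D H \<rho> \<F>
    by unfold_locales (use assms in auto)
  show ?thesis using kH_kernel_exists assms(4,5) by blast
qed

end
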